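(* For the single-output system in observer form $$\dot x_1=x_2,\quad \dot x_2=x_3,\quad\ldots,\quad\dot x_{n-1}=x_n,\quad\dot x_n=p(x_1,\ldots,x_n),\qquad y=x_1,$$ the condition that $[\tau_i,\tau_j]=0$ for all $i,j=1,\ldots,n$ is equivalent to $p(x)$ satisfying the Pascal-Hessian condition.
   Context: Here $p$ is smooth, $x=(x_1,\ldots,x_n)^\top$, and $f_p(x)=(x_2,x_3,\ldots,x_n,p(x))^\top$ is the vector field of the system, with output function $h(x)=x_1$. Lie derivatives and brackets: $L_fh=\frac{\partial h}{\partial x^\top}f$, $L_f^kh=L_f(L_f^{k-1}h)$, and for vector fields $f,g$ the Lie bracket is $[f,g]=\frac{\partial g}{\partial x^\top}f-\frac{\partial f}{\partial x^\top}g$ (in coefficient vectors). The vector fields $\tau_1,\ldots,\tau_n$: $\tau_1$ is the solution of the linear equations $\frac{\partial L_{f_p}^rh(x)}{\partial x^\top}\cdot\tau_1=\delta_{r,n-1}$, $r=0,\ldots,n-1$ (so in the $x$ coordinates $\tau_1=\partial/\partial x_n$), and $\tau_k=[\tau_{k-1},f_p]$ for $k=2,\ldots,n$. Pascal-Hessian condition: for all $1\le i,j\le n$, $$\frac{\partial^2p}{\partial x_i\partial x_j}=\begin{cases}\displaystyle\binom{i+j-2}{i-1}\frac{\partial^2p}{\partial x_1\partial x_{i+j-1}}, & i+j-1\le n,\\[1ex] 0,& i+j-1>n.\end{cases}$$ *)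

theory Defs
  imports "HOL-Analysis.Analysis"
begin

text \<open>
  The state space \<open>\<real>\<^sup>n\<close> is \<^typ>\<open>real ^ 'n\<close> with \<open>n = CARD('n)\<close>. Since a finite index type
  carries no order, the ordering of the coordinates is given by an enumeration
  \<open>e\<close> with \<open>bij_betw e {1..CARD('n)} UNIV\<close>; the coordinate \<open>x\<^sub>i\<close> of \<open>x\<close> is \<open>x $ e i\<close>.
\<close>

primrec Ck :: "nat \<Rightarrow> ('a::real_normed_vector \<Rightarrow> 'b::real_normed_vector) \<Rightarrow> bool" where
  "Ck 0 g \<longleftrightarrow> continuous_on UNIV g"
| "Ck (Suc k) g \<longleftrightarrow> (\<forall>x. g differentiable (at x)) \<and>
     (\<forall>v. Ck k (\<lambda>x. frechet_derivative g (at x) v))"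

definition smooth :: "('a::real_normed_vector \<Rightarrow> 'b::real_normed_vector) \<Rightarrow> bool" where
  "smooth g \<longleftrightarrow> (\<forall>k. Ck k g)"

definition partial_deriv :: "'n::finite \<Rightarrow> (real ^ 'n \<Rightarrow> real) \<Rightarrow> real ^ 'n \<Rightarrow> real" where
  "partial_deriv a g x = frechet_derivative g (at x) (axis a 1)"

definition lie_deriv ::
  "(real ^ 'n \<Rightarrow> real ^ 'n) \<Rightarrow> (real ^ 'n \<Rightarrow> real) \<Rightarrow> real ^ 'n \<Rightarrow> real" where
  "lie_deriv f h x = frechet_derivative h (at x) (f x)"

definition lie_bracket ::
  "(real ^ 'n \<Rightarrow> real ^ 'n) \<Rightarrow> (real ^ 'n \<Rightarrow> real ^ 'n) \<Rightarrow> real ^ 'n \<Rightarrow> real ^ 'n" where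
  "lie_bracket f g x = frechet_derivative g (at x) (f x) - frechet_derivative f (at x) (g x)"

definition observer_field ::
  "(nat \<Rightarrow> 'n::finite) \<Rightarrow> (real ^ 'n \<Rightarrow> real) \<Rightarrow> real ^ 'n \<Rightarrow> real ^ 'n" where
  "observer_field e p x =
     (\<Sum>i = 1..CARD('n). (if i < CARD('n) then x $ e (i + 1) else p x) *\<^sub>R axis (e i) 1)"

definition observer_output :: "(nat \<Rightarrow> 'n::finite) \<Rightarrow> real ^ 'n \<Rightarrow> real" where
  "observer_output e x = x $ e 1"

text \<open>The fields are numbered from 1; the value at index 0 is a dummy.\<close>

fun tau :: "(real ^ 'n \<Rightarrow> real ^ 'n) \<Rightarrow> (real ^ 'n \<Rightarrow> real) \<Rightarrow> nat \<Rightarrow>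
    real ^ 'n::finite \<Rightarrow> real ^ 'n" where
  "tau f h 0 = (\<lambda>x. 0)"
| "tau f h (Suc 0) = (\<lambda>x. THE v. \<forall>r \<in> {0..CARD('n) - 1}.
     frechet_derivative ((lie_deriv f ^^ r) h) (at x) v = (if r = CARD('n) - 1 then 1 else 0))"
| "tau f h (Suc (Suc k)) = lie_bracket (tau f h (Suc k)) f"

definition pascal_hessian :: "(nat \<Rightarrow> 'n::finite) \<Rightarrow> (real ^ 'n \<Rightarrow> real) \<Rightarrow> bool" where
  "pascal_hessian e p \<longleftrightarrow>
     (\<forall>i \<in> {1..CARD('n)}. \<forall>j \<in> {1..CARD('n)}. \<forall>x.
        partial_deriv (e i) (partial_deriv (e j) p) x =
          (if i + j - 1 \<le> CARD('n)
           then of_nat ((i + j - 2) choose (i - 1)) *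
                  partial_deriv (e 1) (partial_deriv (e (i + j - 1)) p) x
           else 0))"

end

theory Submission
  imports Defs
begin

text \<open>
  Write \<open>D\<close> for the derivation along \<open>f\<close> and \<open>L\<close> for the Lie derivative of 1-forms, and number
  coordinates and fields from 0. There are unique functions \<open>\<gamma>\<^sub>k\<close> with \<open>dp = \<Sum>k<n. L\<^sup>k (\<gamma>\<^sub>k dx\<^sub>0)\<close>.
  The 1-forms with \<open>\<Omega>\<^sub>0 = dx\<^sub>0\<close> and \<open>\<Omega>\<^sub>m\<^sub>+\<^sub>1 = L \<Omega>\<^sub>m - \<gamma>\<^sub>n\<^sub>-\<^sub>1\<^sub>-\<^sub>m dx\<^sub>0\<close> then satisfy
  \<open>\<Omega>\<^sub>n = 0\<close>, and from \<open>D \<langle>\<Omega>, v\<rangle> = \<langle>L \<Omega>, v\<rangle> - \<langle>\<Omega>, [v, f]\<rangle>\<close> one finds that they are, up to reversing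
  the order, the frame dual to the \<open>\<tau>\<^sub>k\<close>. Hence the \<open>\<tau>\<^sub>k\<close> commute iff every \<open>\<Omega>\<^sub>m\<close> is closed. Since
  \<open>d\<close> commutes with \<open>L\<close>, this means \<open>d\<gamma>\<^sub>k \<and> dx\<^sub>0 = 0\<close>, that is, every \<open>\<gamma>\<^sub>k\<close> depends on \<open>x\<^sub>0\<close> only. For
  such \<open>\<gamma>\<^sub>k\<close> the partial derivatives of \<open>D\<^sup>r \<gamma>\<^sub>k\<close>, \<open>r < n\<close>, are binomial multiples of \<open>D\<^sup>r\<^sup>-\<^sup>a \<gamma>'\<^sub>k\<close>, and
  comparing coefficients in \<open>dp\<close> gives the Pascal-Hessian condition and, by descending induction on
  \<open>k\<close>, its converse.
\<close>

subsection \<open>Smooth functions\<close>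

lemma Ck_Suc_imp_Ck: "Ck (Suc k) g \<Longrightarrow> Ck k g"
proof (induction k arbitrary: g)
  case 0
  then show ?case
    by (auto intro!: differentiable_imp_continuous_on simp: differentiable_on_def differentiable_at_withinI)
next
  case (Suc k)
  then show ?case by (metis Ck.simps(2))
qed

lemma smooth_differentiable: "smooth g \<Longrightarrow> g differentiable (at x)"
  unfolding smooth_def by (metis Ck.simps(2))

lemma smooth_has_derivative: "smooth g \<Longrightarrow> (g has_derivative frechet_derivative g (at x)) (at x)"
  by (simp add: smooth_differentiable flip: frechet_derivative_works)

lemma smooth_frechet_derivative: "smooth g \<Longrightarrow> smooth (\<lambda>x. frechet_derivative g (at x) v)"
  unfolding smooth_def by (metis Ck.simps(2))

lemma smooth_const [simp]: "smooth (\<lambda>x::'a::real_normed_vector. c::'b::real_normed_vector)"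
proof -
  have "Ck k (\<lambda>x::'a. c::'b)" for k c
    by (induction k arbitrary: c) auto
  then show ?thesis by (simp add: smooth_def)
qed

lemma smooth_bounded_linear:
  assumes "bounded_linear g"
  shows "smooth g"
  unfolding smooth_def
proof
  fix k
  have "frechet_derivative g (at x) = g" for x
    using bounded_linear_imp_has_derivative[OF assms] by (metis frechet_derivative_at)
  then show "Ck k g"
    using assms smooth_const[unfolded smooth_def]
    by (cases k) (auto intro: linear_continuous_on bounded_linear_imp_differentiable)
qed

lemma frechet_derivative_add:
  assumes "g differentiable (at x)" "h differentiable (at x)"
  shows "frechet_derivative (\<lambda>y. g y + h y) (at x) v =
    frechet_derivative g (at x) v + frechet_derivative h (at x) v"
  using frechet_derivative_at[OF has_derivative_add[OF assms[unfolded frechet_derivative_works]]]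
  by metis

lemma frechet_derivative_mult:
  fixes g h :: "'a::real_normed_vector \<Rightarrow> real"
  assumes "g differentiable (at x)" "h differentiable (at x)"
  shows "frechet_derivative (\<lambda>y. g y * h y) (at x) v =
    g x * frechet_derivative h (at x) v + frechet_derivative g (at x) v * h x"
  using frechet_derivative_at[OF has_derivative_mult[OF assms[unfolded frechet_derivative_works]]]
  by metis

lemma Ck_add: "Ck k g \<Longrightarrow> Ck k h \<Longrightarrow> Ck k (\<lambda>x. g x + h x)"
  by (induction k arbitrary: g h) (auto intro: continuous_on_add simp: frechet_derivative_add)

lemma Ck_mult:
  fixes g h :: "'a::real_normed_vector \<Rightarrow> real"
  shows "Ck k g \<Longrightarrow> Ck k h \<Longrightarrow> Ck k (\<lambda>x. g x * h x)"
proof (induction k arbitrary: g h)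
  case 0
  then show ?case by (simp add: continuous_on_mult)
next
  case (Suc k)
  have "Ck k (\<lambda>x. g x * frechet_derivative h (at x) v + frechet_derivative g (at x) v * h x)" for v
    using Suc.prems by (intro Ck_add Suc.IH Ck_Suc_imp_Ck[of k g] Ck_Suc_imp_Ck[of k h]) auto
  then show ?case using Suc.prems by (simp add: frechet_derivative_mult)
qed

lemma smooth_add: "smooth g \<Longrightarrow> smooth h \<Longrightarrow> smooth (\<lambda>x. g x + h x)"
  by (simp add: smooth_def Ck_add)

lemma smooth_mult:
  fixes g h :: "'a::real_normed_vector \<Rightarrow> real"
  shows "smooth g \<Longrightarrow> smooth h \<Longrightarrow> smooth (\<lambda>x. g x * h x)"
  by (simp add: smooth_def Ck_mult)

lemma smooth_uminus:
  fixes g :: "'a::real_normed_vector \<Rightarrow> real"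
  shows "smooth g \<Longrightarrow> smooth (\<lambda>x. - g x)"
  using smooth_mult[of "\<lambda>x. - 1" g] by simp

lemma smooth_diff:
  fixes g h :: "'a::real_normed_vector \<Rightarrow> real"
  shows "smooth g \<Longrightarrow> smooth h \<Longrightarrow> smooth (\<lambda>x. g x - h x)"
  using smooth_add[of g "\<lambda>x. - h x"] smooth_uminus[of h] by simp

section \<open>Symmetry of second derivatives\<close>

lemma has_derivative_along_line:
  assumes "smooth g"
  shows "((\<lambda>s. g (a + s *\<^sub>R u)) has_derivative (\<lambda>h. h *\<^sub>R frechet_derivative g (at (a + s *\<^sub>R u)) u)) (at s within S)"
proof -
  have "((\<lambda>s. a + s *\<^sub>R u) has_derivative (\<lambda>h. h *\<^sub>R u)) (at s within S)"
    by (auto intro!: derivative_eq_intros)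
  from has_derivative_compose[OF this smooth_has_derivative[OF assms]]
  show ?thesis
    using linear_frechet_derivative[OF smooth_differentiable[OF assms]]
    by (simp add: linear_scale)
qed

text \<open>The mean value theorem is used twice: along \<open>u\<close> for the difference of
  \<open>g\<close> over a step in direction \<open>v\<close>, then along \<open>v\<close> for the
  derivative of \<open>g\<close> in direction \<open>u\<close>.\<close>

lemma second_difference_mean_value:
  fixes g :: "'a::real_normed_vector \<Rightarrow> real"
  assumes g: "smooth g" and t: "0 < t"
  obtains a b where "0 < a" "a < t" "0 < b" "b < t"
    "g (x + t *\<^sub>R u + t *\<^sub>R v) - g (x + t *\<^sub>R u) - g (x + t *\<^sub>R v) + g x =
      t * t * frechet_derivative (\<lambda>y. frechet_derivative g (at y) u) (at (x + a *\<^sub>R u + b *\<^sub>R v)) v"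
proof -
  define \<phi> where "\<phi> s = g ((x + t *\<^sub>R v) + s *\<^sub>R u) - g (x + s *\<^sub>R u)" for s
  define g' where "g' y = frechet_derivative g (at y) u" for y
  have g': "smooth g'" unfolding g'_def by (rule smooth_frechet_derivative[OF g])
  have d\<phi>: "(\<phi> has_derivative (\<lambda>h. h * (g' ((x + t *\<^sub>R v) + s *\<^sub>R u) - g' (x + s *\<^sub>R u)))) (at s within S)" for s S
    unfolding \<phi>_def g'_def
    using has_derivative_diff[OF has_derivative_along_line[OF g] has_derivative_along_line[OF g]]
    by (simp add: right_diff_distrib)
  obtain a where a: "0 < a" "a < t" "\<phi> t - \<phi> 0 = t * (g' ((x + t *\<^sub>R v) + a *\<^sub>R u) - g' (x + a *\<^sub>R u))"
    using mvt_simple[OF t d\<phi>] by auto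
  obtain b where b: "0 < b" "b < t"
    "g' ((x + a *\<^sub>R u) + t *\<^sub>R v) - g' ((x + a *\<^sub>R u) + 0 *\<^sub>R v) =
      t * frechet_derivative g' (at ((x + a *\<^sub>R u) + b *\<^sub>R v)) v"
    using mvt_simple[OF t has_derivative_along_line[OF g', of "x + a *\<^sub>R u" v]] by auto
  have "\<phi> t - \<phi> 0 = t * (t * frechet_derivative g' (at ((x + a *\<^sub>R u) + b *\<^sub>R v)) v)"
    using a(3) b(3) by (simp add: algebra_simps)
  then show thesis
    using a(1,2) b(1,2) that[of a b] by (simp add: \<phi>_def g'_def[abs_def] algebra_simps)
qed

text \<open>The second difference quotient is symmetric in \<open>u\<close> and \<open>v\<close>,
  and its mean value form makes it converge to the mixed derivative in either order.\<close>

lemma frechet_derivative_commute: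
  fixes g :: "'a::real_normed_vector \<Rightarrow> real"
  assumes g: "smooth g"
  shows "frechet_derivative (\<lambda>y. frechet_derivative g (at y) u) (at x) v =
    frechet_derivative (\<lambda>y. frechet_derivative g (at y) v) (at x) u"
proof -
  define F where "F u v y = frechet_derivative (\<lambda>y. frechet_derivative g (at y) u) (at y) v" for u v y
  define \<Delta> where "\<Delta> t = (g (x + t *\<^sub>R u + t *\<^sub>R v) - g (x + t *\<^sub>R u) - g (x + t *\<^sub>R v) + g x) / (t * t)" for t
  \<comment> \<open>\<open>u\<close> and \<open>v\<close> are rebound here while \<Delta> keeps the
    outer ones, so the same limit argument serves both orders.\<close>
  have lim: "(\<Delta> \<longlongrightarrow> F u v x) (at_right 0)"
    if ab: "\<And>t. 0 < t \<Longrightarrow> \<exists>a b. 0 < a \<and> a < t \<and> 0 < b \<and> b < t \<and> \<Delta> t = F u v (x + a *\<^sub>R u + b *\<^sub>R v)"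
    for u v
  proof -
    obtain a b where ab: "\<And>t. 0 < t \<Longrightarrow> 0 < a t \<and> a t < t \<and> 0 < b t \<and> b t < t \<and>
        \<Delta> t = F u v (x + a t *\<^sub>R u + b t *\<^sub>R v)"
      using ab by metis
    have pos: "eventually (\<lambda>t::real. 0 < t) (at_right 0)"
      by (simp add: eventually_at_right_less)
    have "(a \<longlongrightarrow> 0) (at_right 0)"
      by (rule tendsto_sandwich[where f = "\<lambda>_. 0" and h = "\<lambda>t. t"])
         (use pos ab in \<open>auto elim!: eventually_mono intro: less_imp_le tendsto_ident_at\<close>)
    moreover have "(b \<longlongrightarrow> 0) (at_right 0)"
      by (rule tendsto_sandwich[where f = "\<lambda>_. 0" and h = "\<lambda>t. t"])
         (use pos ab in \<open>auto elim!: eventually_mono intro: less_imp_le tendsto_ident_at\<close>)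
    ultimately have "((\<lambda>t. x + a t *\<^sub>R u + b t *\<^sub>R v) \<longlongrightarrow> x + 0 *\<^sub>R u + 0 *\<^sub>R v) (at_right 0)"
      by (intro tendsto_intros)
    moreover have "isCont (F u v) x"
      unfolding F_def
      by (intro differentiable_imp_continuous_within smooth_differentiable smooth_frechet_derivative g)
    ultimately have "((\<lambda>t. F u v (x + a t *\<^sub>R u + b t *\<^sub>R v)) \<longlongrightarrow> F u v x) (at_right 0)"
      by (intro isCont_tendsto_compose[of x "F u v"]) auto
    then show ?thesis
      by (rule Lim_transform_eventually) (rule eventually_mono[OF pos], metis ab)
  qed
  have "(\<Delta> \<longlongrightarrow> F u v x) (at_right 0)"
  proof (rule lim)
    fix t :: real assume t: "0 < t"
    obtain a b where ab: "0 < a" "a < t" "0 < b" "b < t" and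
      eq: "g (x + t *\<^sub>R u + t *\<^sub>R v) - g (x + t *\<^sub>R u) - g (x + t *\<^sub>R v) + g x = t * t * F u v (x + a *\<^sub>R u + b *\<^sub>R v)"
      using second_difference_mean_value[OF g t, of x u v] unfolding F_def by blast
    have "\<Delta> t = F u v (x + a *\<^sub>R u + b *\<^sub>R v)"
      unfolding \<Delta>_def eq using t by simp
    with ab show "\<exists>a b. 0 < a \<and> a < t \<and> 0 < b \<and> b < t \<and> \<Delta> t = F u v (x + a *\<^sub>R u + b *\<^sub>R v)"
      by blast
  qed
  moreover have "(\<Delta> \<longlongrightarrow> F v u x) (at_right 0)"
  proof (rule lim)
    fix t :: real assume t: "0 < t"
    obtain a b where ab: "0 < a" "a < t" "0 < b" "b < t" and
      eq: "g (x + t *\<^sub>R v + t *\<^sub>R u) - g (x + t *\<^sub>R v) - g (x + t *\<^sub>R u) + g x = t * t * F v u (x + a *\<^sub>R v + b *\<^sub>R u)"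
      using second_difference_mean_value[OF g t, of x v u] unfolding F_def by blast
    have "\<Delta> t = (g (x + t *\<^sub>R v + t *\<^sub>R u) - g (x + t *\<^sub>R v) - g (x + t *\<^sub>R u) + g x) / (t * t)"
      by (simp add: \<Delta>_def add.assoc add.commute[of "t *\<^sub>R u"])
    then have "\<Delta> t = F v u (x + a *\<^sub>R v + b *\<^sub>R u)"
      unfolding eq using t by simp
    with ab show "\<exists>a b. 0 < a \<and> a < t \<and> 0 < b \<and> b < t \<and> \<Delta> t = F v u (x + a *\<^sub>R v + b *\<^sub>R u)"
      by blast
  qed
  ultimately have "F u v x = F v u x"
    by (intro tendsto_unique) auto
  then show ?thesis by (simp add: F_def)
qed

section \<open>The ring of smooth functions and its derivations\<close>

text \<open>As a type, smooth functions become a commutative ring with directional derivatives as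
  commuting derivations, so the core of the proof can be pure algebra.\<close>

typedef (overloaded) 'a smooth_fun = "{g :: 'a::real_normed_vector \<Rightarrow> real. smooth g}"
  morphisms apply_smooth Smooth
  by (rule exI[of _ "\<lambda>x. 0"]) simp

setup_lifting type_definition_smooth_fun

instantiation smooth_fun :: (real_normed_vector) comm_ring_1
begin

lift_definition zero_smooth_fun :: "'a smooth_fun" is "\<lambda>x. 0" by simp
lift_definition one_smooth_fun :: "'a smooth_fun" is "\<lambda>x. 1" by simp
lift_definition plus_smooth_fun :: "'a smooth_fun \<Rightarrow> 'a smooth_fun \<Rightarrow> 'a smooth_fun"
  is "\<lambda>g h x. g x + h x" by (rule smooth_add)
lift_definition times_smooth_fun :: "'a smooth_fun \<Rightarrow> 'a smooth_fun \<Rightarrow> 'a smooth_fun"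
  is "\<lambda>g h x. g x * h x" by (rule smooth_mult)
lift_definition uminus_smooth_fun :: "'a smooth_fun \<Rightarrow> 'a smooth_fun"
  is "\<lambda>g x. - g x" by (rule smooth_uminus)
lift_definition minus_smooth_fun :: "'a smooth_fun \<Rightarrow> 'a smooth_fun \<Rightarrow> 'a smooth_fun"
  is "\<lambda>g h x. g x - h x" by (rule smooth_diff)

instance
proof
  show "(0::'a smooth_fun) \<noteq> 1" by transfer (simp add: fun_eq_iff)
qed (transfer; simp add: fun_eq_iff algebra_simps)+

end

lemmas apply_smooth_arith [simp] =
  zero_smooth_fun.rep_eq one_smooth_fun.rep_eq plus_smooth_fun.rep_eq times_smooth_fun.rep_eq
  uminus_smooth_fun.rep_eq minus_smooth_fun.rep_eq

lemma apply_smooth_of_nat [simp]: "apply_smooth (of_nat m) x = of_nat m"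
  by (induction m) simp_all

lemma apply_smooth_sum [simp]: "apply_smooth (sum g A) x = (\<Sum>a\<in>A. apply_smooth (g a) x)"
  by (induction A rule: infinite_finite_induct) simp_all

lemma smooth_apply_smooth [simp]: "smooth (apply_smooth g)"
  using apply_smooth[of g] by simp

lemma smooth_fun_eqI: "(\<And>x. apply_smooth g x = apply_smooth h x) \<Longrightarrow> g = h"
  by transfer auto

lift_definition dir_deriv :: "'a::real_normed_vector \<Rightarrow> 'a smooth_fun \<Rightarrow> 'a smooth_fun"
  is "\<lambda>v g x. frechet_derivative g (at x) v"
  by (rule smooth_frechet_derivative)

lemma dir_deriv_add: "dir_deriv v (g + h) = dir_deriv v g + dir_deriv v h"
  by transfer (simp add: frechet_derivative_add smooth_differentiable)

lemma dir_deriv_mult: "dir_deriv v (g * h) = dir_deriv v g * h + g * dir_deriv v h"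
  by transfer (simp add: frechet_derivative_mult smooth_differentiable add.commute)

lemma dir_deriv_commute: "dir_deriv u (dir_deriv v g) = dir_deriv v (dir_deriv u g)"
  by transfer (rule ext, rule frechet_derivative_commute)

subsection \<open>Observer chains over a ring with commuting derivations\<close>

text \<open>Forward substitution: in row \<open>m\<close>, entries left of the diagonal meet values
  already shown to vanish, and entries right of it are 0.\<close>

lemma unitriangular_kernel:
  fixes A :: "nat \<Rightarrow> nat \<Rightarrow> 'r::comm_ring_1"
  assumes ker: "\<And>m. m < n \<Longrightarrow> (\<Sum>l<n. A m l * v l) = 0"
    and upper: "\<And>m l. m < n \<Longrightarrow> l < n \<Longrightarrow> m < l \<Longrightarrow> A m l = 0"
    and diag: "\<And>m. m < n \<Longrightarrow> A m m = 1"
  shows "l < n \<Longrightarrow> v l = 0"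
proof (induction l rule: less_induct)
  case (less m)
  have "(\<Sum>l<n. A m l * v l) = (\<Sum>l<n. if l = m then v m else 0)"
  proof (rule sum.cong)
    fix l assume "l \<in> {..<n}"
    then show "A m l * v l = (if l = m then v m else 0)"
      using less upper[of m l] diag[of m] by (cases l m rule: linorder_cases) auto
  qed simp
  with ker[of m] less.prems show ?case by simp
qed

text \<open>Supplies the functions \<gamma> of the overview. The system is triangular with unit
  diagonal, as \<open>k choose l = 0\<close> for \<open>k < l\<close>, and is solved from the last
  equation downwards; \<open>m\<close> below counts the solved equations.\<close>

lemma binomial_transform_inverse:
  fixes q :: "nat \<Rightarrow> 'r::comm_ring_1" and D :: "'r \<Rightarrow> 'r"
  shows "\<exists>g. \<forall>l<n. q l = (\<Sum>k<n. of_nat (k choose l) * (D ^^ (k - l)) (g k))"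
proof -
  have "\<exists>g. \<forall>l<n. n - m \<le> l \<longrightarrow> q l = (\<Sum>k<n. of_nat (k choose l) * (D ^^ (k - l)) (g k))" for m
  proof (induction m)
    case 0
    then show ?case by auto
  next
    case (Suc m)
    then obtain g where g: "\<And>l. l < n \<Longrightarrow> n - m \<le> l \<Longrightarrow>
        q l = (\<Sum>k<n. of_nat (k choose l) * (D ^^ (k - l)) (g k))" by blast
    show ?case
    proof (cases "m < n")
      case False
      then show ?thesis using g by auto
    next
      case True
      define b where "b = n - Suc m"
      define s where "s = (\<Sum>k\<in>{..<n} - {b}. of_nat (k choose b) * (D ^^ (k - b)) (g k))"
      \<comment> \<open>Equation \<open>b\<close> contains \<open>g b\<close> with coefficient 1, so
        it fixes the new value. Equations with \<open>l > b\<close> do not see the change because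
        \<open>b choose l = 0\<close>.\<close>
      define h where "h = g(b := q b - s)"
      have b: "b < n" "n - m = Suc b" using True by (auto simp: b_def)
      have "q l = (\<Sum>k<n. of_nat (k choose l) * (D ^^ (k - l)) (h k))" if "l < n" "b \<le> l" for l
      proof (cases "l = b")
        case True
        have "(\<Sum>k<n. of_nat (k choose b) * (D ^^ (k - b)) (h k)) = (q b - s) +
            (\<Sum>k\<in>{..<n} - {b}. of_nat (k choose b) * (D ^^ (k - b)) (h k))"
          using b by (subst sum.remove[of _ b]) (auto simp: h_def)
        also have "(\<Sum>k\<in>{..<n} - {b}. of_nat (k choose b) * (D ^^ (k - b)) (h k)) = s"
          unfolding s_def by (rule sum.cong) (auto simp: h_def)
        finally show ?thesis using True by simp
      next
        case False
        then have "b < l" using that by simp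
        then have "q l = (\<Sum>k<n. of_nat (k choose l) * (D ^^ (k - l)) (g k))"
          using g that b by auto
        also have "\<dots> = (\<Sum>k<n. of_nat (k choose l) * (D ^^ (k - l)) (h k))"
          by (rule sum.cong) (use \<open>b < l\<close> in \<open>auto simp: h_def binomial_eq_0\<close>)
        finally show ?thesis .
      qed
      then show ?thesis unfolding b_def by blast
    qed
  qed
  from this[of n] show ?thesis by simp
qed

text \<open>For \<open>a + b \<le> k\<close> both sides are the trinomial coefficient
  \<open>k! / (a! b! (k - a - b)!)\<close>; otherwise both vanish.\<close>

lemma choose_trinomial:
  "(k choose b) * ((k - b) choose a) = ((a + b) choose a) * (k choose (a + b))"
proof (cases "a + b \<le> k")
  case True
  have "(k choose (a + b)) * ((a + b) choose b) = (k choose b) * ((k - b) choose (a + b - b))"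
    by (rule choose_mult) (use True in auto)
  moreover have "(a + b) choose b = (a + b) choose a"
    by (metis add_diff_cancel_right' binomial_symmetric le_add2)
  ultimately show ?thesis by (simp add: mult.commute)
next
  case False
  then show ?thesis by (cases "b \<le> k") (auto simp: binomial_eq_0)
qed

section \<open>Vector fields and 1-forms in coordinates\<close>

text \<open>An algebraic model of smooth functions on the state space: \<open>d i\<close> stands for
  the partial derivative along the coordinate \<open>X i\<close>, counted from 0. Fields and 1-forms
  are coefficient families read only at indices below \<open>n\<close>.\<close>

locale observer_chain =
  fixes n :: nat
    and d :: "nat \<Rightarrow> 'r::comm_ring_1 \<Rightarrow> 'r"
    and X :: "nat \<Rightarrow> 'r"
    and p :: 'r
  assumes n_pos: "0 < n"
    and d_add: "d i (g + h) = d i g + d i h"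
    and d_mult: "d i (g * h) = d i g * h + g * d i h"
    and d_commute: "d i (d j g) = d j (d i g)"
    and d_X: "\<lbrakk>i < n; j < n\<rbrakk> \<Longrightarrow> d i (X j) = (if i = j then 1 else 0)"
begin

definition act :: "(nat \<Rightarrow> 'r) \<Rightarrow> 'r \<Rightarrow> 'r" where
  "act u g = (\<Sum>l<n. u l * d l g)"

definition bracket :: "(nat \<Rightarrow> 'r) \<Rightarrow> (nat \<Rightarrow> 'r) \<Rightarrow> nat \<Rightarrow> 'r" where
  "bracket u v m = act u (v m) - act v (u m)"

definition f :: "nat \<Rightarrow> 'r" where
  "f i = (if Suc i < n then X (Suc i) else p)"

abbreviation D :: "'r \<Rightarrow> 'r" where
  "D \<equiv> act f"

primrec \<tau> :: "nat \<Rightarrow> nat \<Rightarrow> 'r" where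
  "\<tau> 0 = (\<lambda>l. if l = n - 1 then 1 else 0)"
| "\<tau> (Suc k) = bracket (\<tau> k) f"

definition pairing :: "(nat \<Rightarrow> 'r) \<Rightarrow> (nat \<Rightarrow> 'r) \<Rightarrow> 'r" where
  "pairing w v = (\<Sum>l<n. w l * v l)"

text \<open>The Lie derivative of the 1-form \<open>\<Sum>l. w l dx\<^sub>l\<close> along \<open>f\<close>.\<close>

definition lie :: "(nat \<Rightarrow> 'r) \<Rightarrow> nat \<Rightarrow> 'r" where
  "lie w l = D (w l) + (\<Sum>j<n. w j * d l (f j))"

definition closed_form :: "(nat \<Rightarrow> 'r) \<Rightarrow> bool" where
  "closed_form w \<longleftrightarrow> (\<forall>a<n. \<forall>b<n. d a (w b) = d b (w a))"

lemma d_0 [simp]: "d i 0 = 0"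
  using d_add[of i 0 0] by simp

lemma d_1 [simp]: "d i 1 = 0"
  using d_mult[of i 1 1] by simp

lemma d_minus: "d i (- g) = - d i g"
  using d_add[of i g "- g"] by (simp add: eq_neg_iff_add_eq_0 add.commute)

lemma d_diff: "d i (g - h) = d i g - d i h"
  using d_add[of i g "- h"] by (simp add: d_minus)

lemma d_sum: "d i (sum g A) = (\<Sum>a\<in>A. d i (g a))"
  by (induction A rule: infinite_finite_induct) (auto simp: d_add)

lemma d_of_nat [simp]: "d i (of_nat m) = 0"
  by (induction m) (auto simp: d_add)

lemma act_0 [simp]: "act u 0 = 0"
  and act_1 [simp]: "act u 1 = 0"
  and act_of_nat [simp]: "act u (of_nat m) = 0"
  by (simp_all add: act_def)

lemma act_diff: "act u (g - h) = act u g - act u h"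
  by (simp add: act_def d_diff sum_subtractf algebra_simps)

lemma act_mult: "act u (g * h) = act u g * h + g * act u h"
  by (simp add: act_def d_mult sum.distrib sum_distrib_left sum_distrib_right algebra_simps)

lemma act_sum: "act u (sum g A) = (\<Sum>a\<in>A. act u (g a))"
  by (simp add: act_def d_sum sum_distrib_left) (rule sum.swap)

lemma d_f:
  assumes "l < n" "j < n"
  shows "d l (f j) = (if Suc j < n then if l = Suc j then 1 else 0 else d l p)"
  using assms by (simp add: f_def d_X)

text \<open>The Jacobian of \<open>f\<close> is a companion matrix: a shift, with the gradient of
  \<open>p\<close> as last row.\<close>

lemma sum_d_f:
  assumes "l < n"
  shows "(\<Sum>j<n. w j * d l (f j)) = (if l = 0 then 0 else w (l - 1)) + w (n - 1) * d l p"
proof -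
  obtain m where m: "n = Suc m" using n_pos gr0_implies_Suc by blast
  have "(\<Sum>j<n. w j * d l (f j)) = (\<Sum>j<m. w j * d l (f j)) + w m * d l (f m)"
    by (simp add: m)
  also have "(\<Sum>j<m. w j * d l (f j)) = (\<Sum>j<m. if l = Suc j then w j else 0)"
    unfolding f_def by (rule sum.cong) (use assms m in \<open>auto simp: d_X\<close>)
  also have "\<dots> = (if l = 0 then 0 else w (l - 1))"
    using assms m by (cases l) auto
  also have "f m = p" unfolding f_def using m by simp
  finally show ?thesis by (simp add: m)
qed

lemma lie_eq:
  assumes "l < n"
  shows "lie w l = D (w l) + (if l = 0 then 0 else w (l - 1)) + w (n - 1) * d l p"
  by (simp add: lie_def sum_d_f[OF assms] add.assoc)

lemma d_act:
  "d a (act u g) = act u (d a g) + (\<Sum>l<n. d a (u l) * d l g)"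
  by (simp add: act_def d_sum d_mult sum.distrib d_commute[of a] add.commute)

text \<open>The commutator of the a-th partial derivative with \<open>D\<close> is read off from
  column \<open>a\<close> of the Jacobian of \<open>f\<close>.\<close>

lemma d_D:
  assumes "a < n"
  shows "d a (D g) = D (d a g) + (if a = 0 then 0 else d (a - 1) g) + d a p * d (n - 1) g"
  using sum_d_f[OF assms, of "\<lambda>l. d l g"] by (simp add: d_act mult.commute)

text \<open>While \<open>r < n - 1\<close>, \<open>(D ^^ r) g\<close> does not depend on the last
  coordinate, so the term with \<open>p\<close> in \<open>d_D\<close> drops out and what remains is
  Pascal's recursion.\<close>

lemma d_D_power:
  assumes g: "\<And>a. 0 < a \<Longrightarrow> a < n \<Longrightarrow> d a g = 0"
  shows "r < n \<Longrightarrow> a < n \<Longrightarrow>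
    d a ((D ^^ r) g) = of_nat (r choose a) * (D ^^ (r - a)) (d 0 g)"
proof (induction r arbitrary: a)
  case 0
  then show ?case using g[of a] by (cases a) auto
next
  case (Suc r)
  have top: "d (n - 1) ((D ^^ r) g) = 0"
    using Suc.IH[of "n - 1"] Suc.prems by (simp add: binomial_eq_0)
  show ?case
  proof (cases a)
    case 0
    then show ?thesis using Suc top by (simp add: d_D)
  next
    case (Suc b)
    have "d a ((D ^^ Suc r) g) = D (d a ((D ^^ r) g)) + d b ((D ^^ r) g)"
      using Suc Suc.prems top by (simp add: d_D)
    also have "\<dots> = D (of_nat (r choose a) * (D ^^ (r - a)) (d 0 g))
        + of_nat (r choose b) * (D ^^ (r - b)) (d 0 g)"
      using Suc Suc.prems Suc.IH[of a] Suc.IH[of b] by simp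
    also have "\<dots> = of_nat (Suc r choose a) * (D ^^ (Suc r - a)) (d 0 g)"
    proof (cases "a \<le> r")
      case True
      then have "r - b = Suc (r - a)" using Suc by simp
      then show ?thesis using Suc by (simp add: act_mult algebra_simps)
    next
      case False
      then show ?thesis using Suc by (simp add: binomial_eq_0)
    qed
    finally show ?thesis .
  qed
qed

text \<open>Leibniz rule for contracting a 1-form with a field. The minus sign comes from the
  orientation \<open>bracket v f\<close>, the one used to generate the \<open>\<tau>\<close>
  fields.\<close>

lemma act_pairing_lie: "D (pairing w v) = pairing (lie w) v - pairing w (bracket v f)"
proof -
  have "pairing (lie w) v = (\<Sum>l<n. D (w l) * v l) + (\<Sum>l<n. \<Sum>j<n. w j * d l (f j) * v l)"
    by (simp add: pairing_def lie_def distrib_right sum.distrib sum_distrib_right)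
  also have "(\<Sum>l<n. \<Sum>j<n. w j * d l (f j) * v l) = (\<Sum>j<n. w j * act v (f j))"
    by (subst sum.swap) (simp add: act_def sum_distrib_left mult_ac)
  finally show ?thesis
    by (simp add: pairing_def bracket_def act_sum act_mult sum.distrib sum_subtractf algebra_simps)
qed

text \<open>The invariant formula for the exterior derivative of \<open>w\<close>, evaluated on
  \<open>u\<close> and \<open>v\<close>.\<close>

lemma act_pairing_bracket:
  "act u (pairing w v) - act v (pairing w u) - pairing w (bracket u v) =
    (\<Sum>a<n. u a * (\<Sum>b<n. v b * (d a (w b) - d b (w a))))"
proof -
  have 1: "(\<Sum>l<n. act u (w l) * v l) = (\<Sum>a<n. \<Sum>b<n. u a * (v b * d a (w b)))"
    unfolding act_def sum_distrib_right by (subst sum.swap) (simp add: algebra_simps)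
  have 2: "(\<Sum>l<n. act v (w l) * u l) = (\<Sum>a<n. \<Sum>b<n. u a * (v b * d b (w a)))"
    unfolding act_def sum_distrib_right by (simp add: algebra_simps)
  have "act u (pairing w v) - act v (pairing w u) - pairing w (bracket u v) =
      (\<Sum>l<n. act u (w l) * v l) - (\<Sum>l<n. act v (w l) * u l)"
    by (simp add: pairing_def bracket_def act_sum act_mult sum.distrib sum_subtractf algebra_simps)
  also have "\<dots> = (\<Sum>a<n. u a * (\<Sum>b<n. v b * (d a (w b) - d b (w a))))"
    unfolding 1 2 by (simp add: sum_distrib_left sum_subtractf right_diff_distrib)
  finally show ?thesis .
qed

text \<open>The exterior derivative commutes with \<open>lie\<close>. Concretely, closedness
  replaces \<open>d a (w j)\<close> by \<open>d j (w a)\<close>, after which the derivative of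
  \<open>lie w\<close> is visibly symmetric in \<open>a\<close> and \<open>b\<close>.\<close>

lemma closed_form_lie:
  assumes "closed_form w"
  shows "closed_form (lie w)"
  unfolding closed_form_def
proof (intro allI impI)
  have w: "d a (w b) = d b (w a)" if "a < n" "b < n" for a b
    using assms that by (simp add: closed_form_def)
  define S where "S a b = (\<Sum>l<n. d a (f l) * d l (w b))" for a b
  define R where "R a b = (\<Sum>j<n. w j * d a (d b (f j)))" for a b
  have key: "d a (lie w b) = D (d a (w b)) + S a b + S b a + R a b" if "a < n" for a b
  proof -
    have "(\<Sum>j<n. d a (w j) * d b (f j)) = S b a"
      unfolding S_def by (rule sum.cong) (use that w in \<open>auto simp: mult.commute\<close>)
    then show ?thesis
      by (simp add: lie_def d_add d_sum d_mult d_act sum.distrib S_def R_def algebra_simps)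
  qed
  fix a b assume "a < n" "b < n"
  moreover have "R a b = R b a" by (simp add: R_def d_commute[of a])
  ultimately show "d a (lie w b) = d b (lie w a)"
    by (simp add: key w[of a b] algebra_simps)
qed

section \<open>The frame of the \<open>\<tau>\<close> fields and its dual coframe\<close>

text \<open>Each bracket with \<open>f\<close> moves the leading 1 one coordinate down. Entries with
  \<open>l + k > n - 1\<close> depend on \<open>p\<close> and are left open.\<close>

lemma \<tau>_triangular:
  "k < n \<Longrightarrow> l < n \<Longrightarrow> l + k \<le> n - 1 \<Longrightarrow> \<tau> k l = (if l + k = n - 1 then 1 else 0)"
proof (induction k arbitrary: l)
  case (Suc k)
  have l: "Suc l < n" "l < n" using Suc.prems by linarith+
  \<comment> \<open>Here \<open>f l = X (Suc l)\<close>, so acting on it reads off the next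
    component of the field.\<close>
  have "act (\<tau> k) (f l) = (\<Sum>m<n. if m = Suc l then \<tau> k m else 0)"
    unfolding act_def by (rule sum.cong) (use l in \<open>auto simp: d_f\<close>)
  also have "\<dots> = \<tau> k (Suc l)" using l by simp
  finally have "\<tau> (Suc k) l = \<tau> k (Suc l) - D (\<tau> k l)" by (simp add: bracket_def)
  moreover have "\<tau> k l = 0" using Suc l by simp
  moreover have "\<tau> k (Suc l) = (if Suc l + k = n - 1 then 1 else 0)" using Suc l by simp
  ultimately show ?case by simp
qed auto

lemma \<tau>_nondegenerate:
  assumes "\<And>k. k < n \<Longrightarrow> (\<Sum>l<n. \<tau> k l * v l) = 0" and "l < n"
  shows "v l = 0"
proof -
  have "v (n - Suc m) = 0" if "m < n" for m
  \<comment> \<open>Reversing the order of the coordinates turns the antitriangular matrix of the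
    fields into a unitriangular one.\<close>
  proof (rule unitriangular_kernel[where A = "\<lambda>k m. \<tau> k (n - Suc m)" and n = n and
        v = "\<lambda>m. v (n - Suc m)" and l = m])
    fix k assume k: "k < n"
    show "(\<Sum>m<n. \<tau> k (n - Suc m) * v (n - Suc m)) = 0"
      using assms(1)[OF k] sum.nat_diff_reindex[of "\<lambda>l. \<tau> k l * v l" n] by simp
    show "\<tau> k (n - Suc k) = 1" using k by (simp add: \<tau>_triangular)
  next
    fix k m assume "k < n" "m < n" "k < m"
    then show "\<tau> k (n - Suc m) = 0" by (subst \<tau>_triangular) auto
  qed (use that in auto)
  from this[of "n - Suc l"] show ?thesis using assms(2) by simp
qed

text \<open>The assumption is the coefficient form of \<open>dp = \<Sum>k<n. lie\<^sup>k (\<gamma> k dx\<^sub>0)\<close>.\<close>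

context
  fixes \<gamma> :: "nat \<Rightarrow> 'r"
  assumes d_p: "\<And>l. l < n \<Longrightarrow> d l p = (\<Sum>k<n. of_nat (k choose l) * (D ^^ (k - l)) (\<gamma> k))"
begin

text \<open>The recursion of the overview, solved: for \<open>r < n\<close>, the r-th Lie derivative
  of \<open>g dx_0\<close> has the coefficients
  \<open>of_nat (r choose l) * (D ^^ (r - l)) g\<close>, and that of \<open>dx_0\<close> is
  \<open>dx_r\<close>. At \<open>m = n\<close> the leading term lies outside \<open>l < n\<close>,
  so the formula lacks the summand \<open>dp\<close> and gives \<open>-dp\<close> instead of
  0.\<close>

definition \<Omega> :: "nat \<Rightarrow> nat \<Rightarrow> 'r" where
  "\<Omega> m l = (if l = m then 1 else 0)
     - (\<Sum>r<m. of_nat (r choose l) * (D ^^ (r - l)) (\<gamma> (n - m + r)))"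

lemma \<Omega>_triangular: "m \<le> l \<Longrightarrow> \<Omega> m l = (if l = m then 1 else 0)"
  by (simp add: \<Omega>_def binomial_eq_0)

lemma \<Omega>_end: "l < n \<Longrightarrow> \<Omega> n l = - d l p"
  by (simp add: \<Omega>_def d_p)

lemma \<Omega>_Suc:
  assumes "m < n"
  shows "\<Omega> (Suc m) l = (if l = Suc m then 1 else 0) - (if l = 0 then \<gamma> (n - Suc m) else 0)
    - (\<Sum>r<m. of_nat (Suc r choose l) * (D ^^ (Suc r - l)) (\<gamma> (n - m + r)))"
proof -
  \<comment> \<open>Passing from \<open>m\<close> to \<open>Suc m\<close> shifts \<open>r\<close> by
    one with the same \<gamma>; the new term \<open>r = 0\<close> has only a coefficient at
    \<open>l = 0\<close>.\<close>
  have "n - Suc m + Suc r = n - m + r" for r using assms by simp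
  then show ?thesis
    unfolding \<Omega>_def sum.lessThan_Suc_shift by (cases l) (simp_all del: add_Suc_right)
qed

text \<open>Pascal's rule raises every summand by one Lie derivative. The contribution of
  \<open>p\<close> in \<open>lie_eq\<close> is absent for \<open>Suc m < n\<close>; for
  \<open>Suc m = n\<close> it cancels the \<open>-dp\<close> of \<open>\<Omega>_end\<close>.\<close>

lemma lie_\<Omega>:
  assumes m: "m < n" and l: "l < n"
  shows "lie (\<Omega> m) l = (if Suc m < n then \<Omega> (Suc m) l else 0) + (if l = 0 then \<gamma> (n - Suc m) else 0)"
proof -
  \<comment> \<open>This is \<open>lie_eq\<close> without its last term, so it holds uniformly in
    \<open>m < n\<close>.\<close>
  have *: "D (\<Omega> m l) + (if l = 0 then 0 else \<Omega> m (l - 1))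
     = \<Omega> (Suc m) l + (if l = 0 then \<gamma> (n - Suc m) else 0)"
  proof (cases l)
    case 0
    then show ?thesis by (simp add: \<Omega>_Suc[OF m]) (simp add: \<Omega>_def act_diff act_sum)
  next
    case (Suc b)
    have "D (of_nat (r choose l) * (D ^^ (r - l)) g) + of_nat (r choose b) * (D ^^ (r - b)) g
        = of_nat (Suc r choose l) * (D ^^ (Suc r - l)) g" for r g
    proof (cases "l \<le> r")
      case True
      then have "r - b = Suc (r - l)" using Suc by simp
      then show ?thesis using Suc by (simp add: act_mult algebra_simps)
    next
      case False
      then show ?thesis using Suc by (simp add: binomial_eq_0)
    qed
    note step = this[symmetric]
    have "\<Omega> (Suc m) l = (if b = m then 1 else 0)
        - (\<Sum>r<m. D (of_nat (r choose l) * (D ^^ (r - l)) (\<gamma> (n - m + r))))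
        - (\<Sum>r<m. of_nat (r choose b) * (D ^^ (r - b)) (\<gamma> (n - m + r)))"
      unfolding \<Omega>_Suc[OF m] step sum.distrib using Suc by simp
    then show ?thesis using Suc by (simp add: \<Omega>_def act_diff act_sum)
  qed
  show ?thesis
  proof (cases "Suc m < n")
    case True
    then have "\<Omega> m (n - 1) = 0" by (subst \<Omega>_triangular) auto
    then show ?thesis using True * by (simp add: lie_eq[OF l])
  next
    case False
    then have "Suc m = n" using m by simp
    then have "\<Omega> m (n - 1) = 1" "\<Omega> (Suc m) l = - d l p"
      using \<Omega>_triangular[of m "n - 1"] \<Omega>_end[OF l] by auto
    then show ?thesis using False * by (simp add: lie_eq[OF l])
  qed
qed

text \<open>The pairings are constants, hence killed by \<open>D\<close>, so by the Leibniz rule the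
  bracket with \<open>f\<close> moves over to a Lie derivative of the form and \<open>m\<close>
  rises as \<open>k\<close> falls.\<close>

lemma pairing_\<Omega>_\<tau>:
  "k < n \<Longrightarrow> m < n \<Longrightarrow> pairing (\<Omega> m) (\<tau> k) = (if m + k = n - 1 then 1 else 0)"
proof (induction k arbitrary: m)
  case 0
  have "pairing (\<Omega> m) (\<tau> 0) = (\<Sum>l<n. if l = n - 1 then \<Omega> m l else 0)"
    unfolding pairing_def by (rule sum.cong) auto
  also have "\<dots> = \<Omega> m (n - 1)" using n_pos by simp
  finally show ?case using 0 by (auto simp: \<Omega>_triangular)
next
  case (Suc k)
  \<comment> \<open>With no component along coordinate 0, the field does not see the correction
    \<open>\<gamma> dx_0\<close> in \<open>lie_\<Omega>\<close>.\<close>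
  have head: "\<tau> k 0 = 0" using Suc.prems by (subst \<tau>_triangular) auto
  have "pairing (lie (\<Omega> m)) (\<tau> k) =
      (\<Sum>l<n. (if Suc m < n then \<Omega> (Suc m) l else 0) * \<tau> k l)"
    unfolding pairing_def
    by (rule sum.cong) (use head Suc.prems in \<open>auto simp: lie_\<Omega>\<close>)
  also have "\<dots> = (if Suc m < n then pairing (\<Omega> (Suc m)) (\<tau> k) else 0)"
    by (simp add: pairing_def)
  also have "\<dots> = (if m + Suc k = n - 1 then 1 else 0)"
    using Suc.prems Suc.IH[of "Suc m"] by auto
  finally show ?case
    using act_pairing_lie[of "\<Omega> m" "\<tau> k"] Suc.IH[of m] Suc.prems by (simp split: if_splits)
qed

text \<open>On a dual frame and coframe the pairings are constant, so the invariant formula leaves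
  only the pairing with the bracket and the exterior derivative.\<close>

lemma brackets_zero_iff_closed:
  "(\<forall>i<n. \<forall>j<n. \<forall>m<n. bracket (\<tau> i) (\<tau> j) m = 0) \<longleftrightarrow> (\<forall>m<n. closed_form (\<Omega> m))"
proof -
  have key: "- pairing (\<Omega> m) (bracket (\<tau> i) (\<tau> j)) =
      (\<Sum>a<n. \<tau> i a * (\<Sum>b<n. \<tau> j b * (d a (\<Omega> m b) - d b (\<Omega> m a))))"
    if "i < n" "j < n" "m < n" for i j m
    using act_pairing_bracket[of "\<tau> i" "\<Omega> m" "\<tau> j"] that
    by (simp add: pairing_\<Omega>_\<tau> split: if_splits)
  show ?thesis
  proof (intro iffI allI impI)
    fix m assume br: "\<forall>i<n. \<forall>j<n. \<forall>m<n. bracket (\<tau> i) (\<tau> j) m = 0" and m: "m < n"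
    have "(\<Sum>a<n. \<tau> i a * (\<Sum>b<n. \<tau> j b * (d a (\<Omega> m b) - d b (\<Omega> m a)))) = 0"
      if "i < n" "j < n" for i j
      using key[OF that m] br that by (simp add: pairing_def)
    \<comment> \<open>Nondegeneracy of the frame is used once per slot of the 2-form, first for
      \<open>a\<close>, then for \<open>b\<close>.\<close>
    then have "(\<Sum>b<n. \<tau> j b * (d a (\<Omega> m b) - d b (\<Omega> m a))) = 0" if "j < n" "a < n" for j a
      using \<tau>_nondegenerate[where v = "\<lambda>a. (\<Sum>b<n. \<tau> j b * (d a (\<Omega> m b) - d b (\<Omega> m a)))"] that
      by blast
    then have "d a (\<Omega> m b) - d b (\<Omega> m a) = 0" if "a < n" "b < n" for a b
      using \<tau>_nondegenerate[where v = "\<lambda>b. d a (\<Omega> m b) - d b (\<Omega> m a)"] that by blast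
    then show "closed_form (\<Omega> m)" by (simp add: closed_form_def)
  next
    fix i j m assume cl: "\<forall>m<n. closed_form (\<Omega> m)" and ij: "i < n" "j < n" and m: "m < n"
    show "bracket (\<tau> i) (\<tau> j) m = 0"
    \<comment> \<open>The bracket is annihilated by every \<open>\<Omega> m\<close>, and these form
      a unitriangular matrix.\<close>
    proof (rule unitriangular_kernel[OF _ _ _ m])
      fix m assume m: "m < n"
      have "(\<Sum>a<n. \<tau> i a * (\<Sum>b<n. \<tau> j b * (d a (\<Omega> m b) - d b (\<Omega> m a)))) = 0"
        using cl m by (simp add: closed_form_def)
      then show "(\<Sum>l<n. \<Omega> m l * bracket (\<tau> i) (\<tau> j) l) = 0"
        using key[OF ij m] by (simp add: pairing_def)
    qed (auto simp: \<Omega>_triangular)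
  qed
qed

section \<open>From closed forms to the Pascal-Hessian condition\<close>

lemma closed_iff_\<gamma>:
  "(\<forall>m<n. closed_form (\<Omega> m)) \<longleftrightarrow> (\<forall>k<n. \<forall>a<n. 0 < a \<longrightarrow> d a (\<gamma> k) = 0)"
proof (intro iffI allI impI)
  fix k a assume cl: "\<forall>m<n. closed_form (\<Omega> m)" and k: "k < n" and a: "a < n" "0 < a"
  \<comment> \<open>Chosen so that \<gamma> at \<open>k\<close> is the correction between
    \<open>lie (\<Omega> m)\<close> and the next form; two closed forms then differ by the closed
    form \<open>\<gamma> k dx_0\<close>.\<close>
  define m where "m = n - Suc k"
  have m: "m < n" "n - Suc m = k" using k by (auto simp: m_def)
  have "d a (lie (\<Omega> m) 0) = d 0 (lie (\<Omega> m) a)"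
    using closed_form_lie cl m a n_pos by (simp add: closed_form_def)
  moreover have "d a (\<Omega> (Suc m) 0) = d 0 (\<Omega> (Suc m) a)" if "Suc m < n"
    using cl that a n_pos by (simp add: closed_form_def)
  ultimately show "d a (\<gamma> k) = 0"
    using m a n_pos by (simp add: lie_\<Omega> d_add split: if_splits)
next
  fix m assume g: "\<forall>k<n. \<forall>a<n. 0 < a \<longrightarrow> d a (\<gamma> k) = 0"
  show "m < n \<Longrightarrow> closed_form (\<Omega> m)"
  proof (induction m)
    case 0
    show ?case by (simp add: closed_form_def \<Omega>_triangular)
  next
    case (Suc m)
    then have m: "m < n" "Suc m < n" and cl: "closed_form (lie (\<Omega> m))"
      by (auto intro: closed_form_lie)
    \<comment> \<open>The correction affects only the entry \<open>a = b = 0\<close>, which is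
      irrelevant to symmetry.\<close>
    have "d a (\<Omega> (Suc m) b) = d a (lie (\<Omega> m) b) - (if b = 0 \<and> a = 0 then d 0 (\<gamma> (n - Suc m)) else 0)"
      if "a < n" "b < n" for a b
      using g that m by (auto simp: lie_\<Omega> d_add)
    then show ?case using cl by (auto simp: closed_form_def)
  qed
qed

text \<open>By \<open>choose_trinomial\<close> only indices \<open>k \<ge> a + b\<close> contribute,
  so cutting the sum at \<open>c \<le> a + b\<close> loses nothing. The cut lets the lemma be used
  when only the later \<gamma> are known to depend on coordinate 0 alone.\<close>

lemma d_d_p:
  assumes g: "\<And>k a. c \<le> k \<Longrightarrow> k < n \<Longrightarrow> 0 < a \<Longrightarrow> a < n \<Longrightarrow> d a (\<gamma> k) = 0"
    and "a < n" "b < n" "c \<le> a + b"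
  shows "(\<Sum>k\<in>{c..<n}. of_nat (k choose b) * d a ((D ^^ (k - b)) (\<gamma> k))) =
    (if a + b < n then of_nat ((a + b) choose a) * d 0 (d (a + b) p) else 0)"
proof -
  have rest: "k choose (a + b) = 0" if "k < c" for k
    using that assms by (simp add: binomial_eq_0)
  have "(\<Sum>k\<in>{c..<n}. of_nat (k choose b) * d a ((D ^^ (k - b)) (\<gamma> k))) =
     (\<Sum>k\<in>{c..<n}. of_nat ((a + b) choose a) * of_nat (k choose (a + b))
        * (D ^^ (k - (a + b))) (d 0 (\<gamma> k)))"
  proof (rule sum.cong)
    fix k assume k: "k \<in> {c..<n}"
    have "d a ((D ^^ (k - b)) (\<gamma> k)) = of_nat (k - b choose a) * (D ^^ (k - b - a)) (d 0 (\<gamma> k))"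
      by (rule d_D_power) (use g k assms in auto)
    then show "of_nat (k choose b) * d a ((D ^^ (k - b)) (\<gamma> k)) =
       of_nat ((a + b) choose a) * of_nat (k choose (a + b)) * (D ^^ (k - (a + b))) (d 0 (\<gamma> k))"
      using choose_trinomial[of k b a]
      by (simp flip: of_nat_mult mult.assoc add: diff_diff_left add.commute)
  qed simp
  also have "\<dots> = of_nat ((a + b) choose a) *
     (\<Sum>k\<in>{c..<n}. of_nat (k choose (a + b)) * (D ^^ (k - (a + b))) (d 0 (\<gamma> k)))"
    by (simp add: sum_distrib_left mult.assoc)
  also have "(\<Sum>k\<in>{c..<n}. of_nat (k choose (a + b)) * (D ^^ (k - (a + b))) (d 0 (\<gamma> k))) =
     (\<Sum>k\<in>{c..<n}. d 0 (of_nat (k choose (a + b)) * (D ^^ (k - (a + b))) (\<gamma> k)))"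
  proof (rule sum.cong)
    fix k assume k: "k \<in> {c..<n}"
    have "d 0 ((D ^^ (k - (a + b))) (\<gamma> k)) = of_nat (k - (a + b) choose 0) * (D ^^ (k - (a + b) - 0)) (d 0 (\<gamma> k))"
      by (rule d_D_power) (use g k assms in auto)
    then show "of_nat (k choose (a + b)) * (D ^^ (k - (a + b))) (d 0 (\<gamma> k)) =
      d 0 (of_nat (k choose (a + b)) * (D ^^ (k - (a + b))) (\<gamma> k))"
      by (simp add: d_mult)
  qed simp
  also have "\<dots> = (\<Sum>k<n. d 0 (of_nat (k choose (a + b)) * (D ^^ (k - (a + b))) (\<gamma> k)))"
    by (rule sum.mono_neutral_left) (auto simp: rest)
  also have "\<dots> = (if a + b < n then d 0 (d (a + b) p) else 0)"
    by (auto simp: d_p d_sum binomial_eq_0)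
  finally show ?thesis by simp
qed

lemma \<gamma>_iff_pascal:
  "(\<forall>k<n. \<forall>a<n. 0 < a \<longrightarrow> d a (\<gamma> k) = 0) \<longleftrightarrow>
   (\<forall>a<n. \<forall>b<n. d a (d b p) =
      (if a + b < n then of_nat ((a + b) choose a) * d 0 (d (a + b) p) else 0))"
    (is "?G \<longleftrightarrow> ?P")
proof
  assume g: ?G
  show ?P
  proof (intro allI impI)
    fix a b assume ab: "a < n" "b < n"
    have "d a (d b p) = (\<Sum>k\<in>{0..<n}. of_nat (k choose b) * d a ((D ^^ (k - b)) (\<gamma> k)))"
      using ab by (simp add: d_p d_sum d_mult lessThan_atLeast0)
    then show "d a (d b p) =
        (if a + b < n then of_nat ((a + b) choose a) * d 0 (d (a + b) p) else 0)"
      using d_d_p[of 0 a b] g ab by simp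
  qed
next
  assume P: ?P
  have "\<forall>a<n. 0 < a \<longrightarrow> d a (\<gamma> k) = 0" if "k < n" for k
    using that
  \<comment> \<open>Descending induction on \<open>k\<close>.\<close>
  proof (induction "n - k" arbitrary: k rule: less_induct)
    case less
    show ?case
    proof (intro allI impI)
      fix a assume a: "a < n" "0 < a"
      have "d a (d k p) = (\<Sum>j\<in>{..<n}. of_nat (j choose k) * d a ((D ^^ (j - k)) (\<gamma> j)))"
        using less.prems by (simp add: d_p d_sum d_mult)
      also have "\<dots> = (\<Sum>j\<in>{k..<n}. of_nat (j choose k) * d a ((D ^^ (j - k)) (\<gamma> j)))"
        by (rule sum.mono_neutral_right) (auto simp: binomial_eq_0)
      \<comment> \<open>The term \<open>j = k\<close> has binomial 1 and no power of
        \<open>D\<close>; it isolates the unknown derivative.\<close>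
      also have "\<dots> = d a (\<gamma> k) +
          (\<Sum>j\<in>{Suc k..<n}. of_nat (j choose k) * d a ((D ^^ (j - k)) (\<gamma> j)))"
        using less.prems by (simp add: sum.atLeast_Suc_lessThan)
      \<comment> \<open>Taken with \<open>c = Suc k\<close>, which is at most \<open>a + k\<close>
        because \<open>0 < a\<close>. By hypothesis the remainder already equals the whole left
        side, so the isolated term is 0.\<close>
      also have "(\<Sum>j\<in>{Suc k..<n}. of_nat (j choose k) * d a ((D ^^ (j - k)) (\<gamma> j))) =
          (if a + k < n then of_nat ((a + k) choose a) * d 0 (d (a + k) p) else 0)"
        by (rule d_d_p) (use less a in auto)
      also have "\<dots> = d a (d k p)" using P a less.prems by simp
      finally show "d a (\<gamma> k) = 0" by simp
    qed
  qed
  then show ?G by blast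
qed

end

theorem brackets_zero_iff_pascal:
  "(\<forall>i<n. \<forall>j<n. \<forall>m<n. bracket (\<tau> i) (\<tau> j) m = 0) \<longleftrightarrow>
   (\<forall>a<n. \<forall>b<n. d a (d b p) =
      (if a + b < n then of_nat ((a + b) choose a) * d 0 (d (a + b) p) else 0))"
proof -
  obtain \<gamma> where "\<And>l. l < n \<Longrightarrow> d l p = (\<Sum>k<n. of_nat (k choose l) * (D ^^ (k - l)) (\<gamma> k))"
    using binomial_transform_inverse[of n "\<lambda>l. d l p" D] by blast
  note \<gamma> = this
  show ?thesis
    using brackets_zero_iff_closed[OF \<gamma>] closed_iff_\<gamma>[OF \<gamma>] \<gamma>_iff_pascal[OF \<gamma>] by (simp only:)
qed

end

subsection \<open>Observer systems with smooth right-hand side\<close>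

locale smooth_observer =
  fixes e :: "nat \<Rightarrow> 'n::finite" and p :: "real ^ 'n \<Rightarrow> real"
  assumes bij_e: "bij_betw e {1..CARD('n)} UNIV"
    and smooth_p: "smooth p"
begin

text \<open>The algebra counts coordinates from 0 and \<open>e\<close> counts from 1, whence the
  \<open>Suc\<close> here and below.\<close>

definition \<delta> :: "nat \<Rightarrow> (real ^ 'n) smooth_fun \<Rightarrow> (real ^ 'n) smooth_fun" where
  "\<delta> i = dir_deriv (axis (e (Suc i)) 1)"

definition coord :: "nat \<Rightarrow> (real ^ 'n) smooth_fun" where
  "coord i = Smooth (\<lambda>x. x $ e (Suc i))"

definition to_field :: "(nat \<Rightarrow> (real ^ 'n) smooth_fun) \<Rightarrow> real ^ 'n \<Rightarrow> real ^ 'n" where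
  "to_field V x = (\<Sum>i<CARD('n). apply_smooth (V i) x *\<^sub>R axis (e (Suc i)) 1)"

lemma e_eq_iff: "i < CARD('n) \<Longrightarrow> j < CARD('n) \<Longrightarrow> e (Suc i) = e (Suc j) \<longleftrightarrow> i = j"
  using bij_e by (auto simp: bij_betw_def dest: inj_onD)

lemma vec_eqI: "(\<And>i. i < CARD('n) \<Longrightarrow> v $ e (Suc i) = w $ e (Suc i)) \<Longrightarrow> v = w"
proof (rule vec_eq_iff[THEN iffD2], rule allI)
  fix a assume *: "\<And>i. i < CARD('n) \<Longrightarrow> v $ e (Suc i) = w $ e (Suc i)"
  obtain j where "j \<in> {1..CARD('n)}" "a = e j"
    using bij_e unfolding bij_betw_def by blast
  then show "v $ a = w $ a" using *[of "j - 1"] by auto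
qed

lemma apply_coord [simp]: "apply_smooth (coord i) = (\<lambda>x. x $ e (Suc i))"
  unfolding coord_def
  by (subst Smooth_inverse) (auto intro: smooth_bounded_linear bounded_linear_vec_nth)

lemma apply_Smooth_p [simp]: "apply_smooth (Smooth p) = p"
  using smooth_p by (simp add: Smooth_inverse)

lemma frechet_derivative_nth: "frechet_derivative (\<lambda>x. x $ a) (at x) v = v $ a"
  using frechet_derivative_at[OF bounded_linear_imp_has_derivative[OF bounded_linear_vec_nth]]
  by metis

sublocale observer_chain "CARD('n)" \<delta> coord "Smooth p"
proof
  fix i j assume "i < CARD('n)" "j < CARD('n)"
  then show "\<delta> i (coord j) = (if i = j then 1 else 0)"
    by (intro smooth_fun_eqI)
       (auto simp: \<delta>_def dir_deriv.rep_eq frechet_derivative_nth axis_def e_eq_iff)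
qed (simp_all add: \<delta>_def dir_deriv_add dir_deriv_mult, rule dir_deriv_commute)

lemma partial_deriv_apply: "partial_deriv (e (Suc i)) (apply_smooth g) = apply_smooth (\<delta> i g)"
  by (simp add: fun_eq_iff partial_deriv_def \<delta>_def dir_deriv.rep_eq)

lemma to_field_nth:
  assumes "l < CARD('n)"
  shows "to_field V x $ e (Suc l) = apply_smooth (V l) x"
proof -
  have "to_field V x $ e (Suc l) = (\<Sum>i<CARD('n). if i = l then apply_smooth (V i) x else 0)"
    unfolding to_field_def sum_component
    by (rule sum.cong) (use assms in \<open>auto simp: axis_def e_eq_iff\<close>)
  with assms show ?thesis by simp
qed

lemma frechet_derivative_apply_to_field:
  "frechet_derivative (apply_smooth g) (at x) (to_field U x) = apply_smooth (act U g) x"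
proof -
  have "linear (frechet_derivative (apply_smooth g) (at x))"
    by (intro linear_frechet_derivative smooth_differentiable) simp
  then show ?thesis
    by (simp add: to_field_def act_def \<delta>_def dir_deriv.rep_eq linear_sum linear_scale)
qed

lemma frechet_derivative_to_field:
  "frechet_derivative (to_field V) (at x) (to_field U x) = to_field (\<lambda>m. act U (V m)) x"
proof -
  have "((\<lambda>x. to_field V x) has_derivative (\<lambda>v. \<Sum>i<CARD('n).
      frechet_derivative (apply_smooth (V i)) (at x) v *\<^sub>R axis (e (Suc i)) 1)) (at x)"
    unfolding to_field_def
    by (intro has_derivative_sum has_derivative_scaleR_left smooth_has_derivative) simp
  from frechet_derivative_at[OF this, symmetric] show ?thesis
    by (simp add: frechet_derivative_apply_to_field) (simp add: to_field_def)
qed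

lemma lie_bracket_to_field: "lie_bracket (to_field U) (to_field V) = to_field (bracket U V)"
  by (simp add: fun_eq_iff lie_bracket_def frechet_derivative_to_field)
     (simp add: to_field_def bracket_def sum_subtractf scaleR_diff_left)

lemma observer_field_eq: "observer_field e p = to_field f"
proof
  fix x
  have "observer_field e p x =
      (\<Sum>i<CARD('n). (if Suc i < CARD('n) then x $ e (Suc i + 1) else p x) *\<^sub>R axis (e (Suc i)) 1)"
    by (simp add: observer_field_def sum.atLeast1_atMost_eq)
  also have "\<dots> = to_field f x"
    unfolding to_field_def f_def by (rule sum.cong) auto
  finally show "observer_field e p x = to_field f x" .
qed

text \<open>Each Lie derivative moves to the next coordinate, and \<open>p\<close> is not reached
  while \<open>r < n\<close>. The linear system defining the first field thus has the identity
  matrix, up to the ordering \<open>e\<close>.\<close>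

lemma lie_deriv_power_output:
  "r < CARD('n) \<Longrightarrow> (lie_deriv (to_field f) ^^ r) (observer_output e) = (\<lambda>x. x $ e (Suc r))"
proof (induction r)
  case 0
  then show ?case by (simp add: observer_output_def[abs_def])
next
  case (Suc r)
  then have "(lie_deriv (to_field f) ^^ Suc r) (observer_output e) =
      lie_deriv (to_field f) (\<lambda>x. x $ e (Suc r))" by simp
  also have "\<dots> = (\<lambda>x. x $ e (Suc (Suc r)))"
    using Suc.prems by (simp add: fun_eq_iff lie_deriv_def frechet_derivative_nth to_field_nth f_def)
  finally show ?case .
qed

lemma tau_eq: "tau (to_field f) (observer_output e) (Suc k) = to_field (\<tau> k)"
proof (induction k)
  case 0
  have "tau (to_field f) (observer_output e) (Suc 0) x = to_field (\<tau> 0) x" for x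
    unfolding tau.simps
  \<comment> \<open>The equations prescribe every coordinate of the vector, which gives both
    existence and uniqueness.\<close>
  proof (rule the_equality)
    show "\<forall>r\<in>{0..CARD('n) - 1}. frechet_derivative ((lie_deriv (to_field f) ^^ r) (observer_output e))
        (at x) (to_field (\<tau> 0) x) = (if r = CARD('n) - 1 then 1 else 0)"
    proof
      fix r assume "r \<in> {0..CARD('n) - 1}"
      then have r: "r < CARD('n)" using n_pos unfolding atLeastAtMost_iff by linarith
      show "frechet_derivative ((lie_deriv (to_field f) ^^ r) (observer_output e)) (at x)
          (to_field (\<tau> 0) x) = (if r = CARD('n) - 1 then 1 else 0)"
        unfolding lie_deriv_power_output[OF r] frechet_derivative_nth to_field_nth[OF r] by simp
    qed
  next
    fix v
    assume v: "\<forall>r\<in>{0..CARD('n) - 1}. frechet_derivative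
        ((lie_deriv (to_field f) ^^ r) (observer_output e)) (at x) v = (if r = CARD('n) - 1 then 1 else 0)"
    show "v = to_field (\<tau> 0) x"
    proof (rule vec_eqI)
      fix i assume i: "i < CARD('n)"
      then have "i \<in> {0..CARD('n) - 1}" by simp
      with v i show "v $ e (Suc i) = to_field (\<tau> 0) x $ e (Suc i)"
        by (auto simp: lie_deriv_power_output frechet_derivative_nth to_field_nth)
    qed
  qed
  then show ?case by (rule ext)
next
  case (Suc k)
  then show ?case by (simp add: lie_bracket_to_field)
qed

lemma to_field_eq_0_iff: "(\<forall>x. to_field V x = 0) \<longleftrightarrow> (\<forall>m<CARD('n). V m = 0)"
proof (intro iffI allI impI)
  fix m assume V: "\<forall>x. to_field V x = 0" and "m < CARD('n)"
  then show "V m = 0" by (metis V smooth_fun_eqI to_field_nth zero_index zero_smooth_fun.rep_eq)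
qed (simp add: to_field_def)

lemma ball_1_card: "(\<forall>i\<in>{1..CARD('n)}. P i) \<longleftrightarrow> (\<forall>i<CARD('n). P (Suc i))"
  unfolding image_Suc_lessThan[symmetric] by blast

lemma pascal_hessian_iff:
  "pascal_hessian e p \<longleftrightarrow> (\<forall>a<CARD('n). \<forall>b<CARD('n). \<delta> a (\<delta> b (Smooth p)) =
     (if a + b < CARD('n) then of_nat ((a + b) choose a) * \<delta> 0 (\<delta> (a + b) (Smooth p)) else 0))"
proof -
  have p: "partial_deriv (e (Suc i)) p = apply_smooth (\<delta> i (Smooth p))" for i
    using partial_deriv_apply[of i "Smooth p"] by simp
  \<comment> \<open>With \<open>i = Suc a\<close> and \<open>j = Suc b\<close>, the index
    \<open>i + j - 1\<close> is \<open>Suc (a + b)\<close> and the bound becomes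
    \<open>a + b < n\<close>.\<close>
  have eq: "(\<forall>x. partial_deriv (e (Suc a)) (partial_deriv (e (Suc b)) p) x =
      (if Suc a + Suc b - 1 \<le> CARD('n)
       then of_nat ((Suc a + Suc b - 2) choose (Suc a - 1)) *
            partial_deriv (e 1) (partial_deriv (e (Suc a + Suc b - 1)) p) x
       else 0)) \<longleftrightarrow>
     \<delta> a (\<delta> b (Smooth p)) =
     (if a + b < CARD('n) then of_nat ((a + b) choose a) * \<delta> 0 (\<delta> (a + b) (Smooth p)) else 0)" for a b
    by (auto simp: p partial_deriv_apply Suc_le_eq intro!: smooth_fun_eqI)
  show ?thesis
    unfolding pascal_hessian_def ball_1_card eq by simp
qed

lemma lie_brackets_zero_iff:
  "(\<forall>i \<in> {1..CARD('n)}. \<forall>j \<in> {1..CARD('n)}. \<forall>x.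
      lie_bracket (tau (observer_field e p) (observer_output e) i)
                  (tau (observer_field e p) (observer_output e) j) x = 0) \<longleftrightarrow>
   (\<forall>i<CARD('n). \<forall>j<CARD('n). \<forall>m<CARD('n). bracket (\<tau> i) (\<tau> j) m = 0)"
  unfolding ball_1_card observer_field_eq tau_eq lie_bracket_to_field to_field_eq_0_iff ..

end

theorem theorem4:
  fixes e :: "nat \<Rightarrow> 'n::finite"
    and p :: "real ^ 'n \<Rightarrow> real"
  assumes "bij_betw e {1..CARD('n)} UNIV"
    and "smooth p"
  shows "(\<forall>i \<in> {1..CARD('n)}. \<forall>j \<in> {1..CARD('n)}. \<forall>x.
            lie_bracket (tau (observer_field e p) (observer_output e) i)
                        (tau (observer_field e p) (observer_output e) j) x = 0)
         \<longleftrightarrow> pascal_hessian e p"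
proof -
  interpret smooth_observer e p
    using assms by unfold_locales
  show ?thesis
    unfolding lie_brackets_zero_iff pascal_hessian_iff by (rule brackets_zero_iff_pascal)
qed

end
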